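(* For all integers $k_1,k_2\ge 0$, $$\sum_{\mu} g_{k_1+\frac12}(\mu)\, g_{k_2+\frac12}(\mu)=B(k_1+k_2+1),$$ where the sum is over all integer partitions $\mu$ and $B(m)$ denotes the $m$-th Bell number.
   Context: Integer partitions are identified with their Young diagrams and ordered by containment; $\emptyset$ is the only partition of $0$. A simplified vacillating tableau of shape $\mu$ and length $2k+1$ is a sequence of $2k+2$ integer partitions $(\mu^{(0)}=\emptyset,\mu^{(1/2)},\mu^{(1)},\dots,\mu^{(k)},\mu^{(k+1/2)}=\mu)$ such that (a) for each integer $j=0,\dots,k$: $\mu^{(j)}\supseteq\mu^{(j+1/2)}$ and $|\mu^{(j)}/\mu^{(j+1/2)}|\in\{0,1\}$; (b) for each integer $j=0,\dots,k-1$: $\mu^{(j+1/2)}\subseteq\mu^{(j+1)}$ and $|\mu^{(j+1)}/\mu^{(j+1/2)}|\in\{0,1\}$. $g_{k+\frac12}(\mu)$ is the number of simplified vacillating tableaux of shape $\mu$ and length $2k+1$. The Bell number $B(m)$ is the number of set partitions of $\{1,\dots,m\}$. *)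

theory Defs
  imports "HOL-Library.Disjoint_Sets" "HOL-Analysis.Infinite_Sum"
begin

definition integer_partition :: "nat list \<Rightarrow> bool" where
  "integer_partition \<nu> \<longleftrightarrow> sorted_wrt (\<ge>) \<nu> \<and> 0 \<notin> set \<nu>"

definition young_diagram :: "nat list \<Rightarrow> (nat \<times> nat) set" where
  "young_diagram \<nu> = {(i, j). i < length \<nu> \<and> j < \<nu> ! i}"

text \<open>A sequence indexed by half-integers is encoded as a list: the entry \<^term>\<open>T ! i\<close>
  is the partition with index $i/2$.\<close>

definition simplified_vacillating_tableau :: "nat \<Rightarrow> nat list \<Rightarrow> nat list list \<Rightarrow> bool" where
  "simplified_vacillating_tableau k \<mu> T \<longleftrightarrow>
     length T = 2 * k + 2 \<and> (\<forall>\<nu>\<in>set T. integer_partition \<nu>) \<and>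
     T ! 0 = [] \<and> T ! (2 * k + 1) = \<mu> \<and>
     (\<forall>j\<le>k. young_diagram (T ! (2 * j + 1)) \<subseteq> young_diagram (T ! (2 * j)) \<and>
        card (young_diagram (T ! (2 * j)) - young_diagram (T ! (2 * j + 1))) \<in> {0, 1}) \<and>
     (\<forall>j<k. young_diagram (T ! (2 * j + 1)) \<subseteq> young_diagram (T ! (2 * j + 2)) \<and>
        card (young_diagram (T ! (2 * j + 2)) - young_diagram (T ! (2 * j + 1))) \<in> {0, 1})"

text \<open>\<^term>\<open>num_svt k \<mu>\<close> is $g_{k+1/2}(\mu)$.\<close>

definition num_svt :: "nat \<Rightarrow> nat list \<Rightarrow> nat" where
  "num_svt k \<mu> = card {T. simplified_vacillating_tableau k \<mu> T}"

definition bell :: "nat \<Rightarrow> nat" where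
  "bell m = card {P. partition_on {1..m} P}"

text \<open>The diagram determines the partition, and its cardinality is the size of the partition,
  so containment and skew size may be read off from diagrams as above.\<close>

lemma young_diagram_conv_Sigma: "young_diagram \<nu> = (SIGMA i:{..<length \<nu>}. {..<\<nu> ! i})"
  by (auto simp: young_diagram_def)

lemma finite_young_diagram: "finite (young_diagram \<nu>)"
  by (simp add: young_diagram_conv_Sigma)

lemma card_young_diagram: "card (young_diagram \<nu>) = sum_list \<nu>"
  by (simp add: young_diagram_conv_Sigma sum_list_sum_nth atLeast0LessThan)

lemma young_diagram_row:
  "{j. (i, j) \<in> young_diagram \<nu>} = {..<(if i < length \<nu> then \<nu> ! i else 0)}"
  by (auto simp: young_diagram_def)

lemma young_diagram_inj:
  assumes "integer_partition \<nu>" "integer_partition \<mu>" "young_diagram \<nu> = young_diagram \<mu>"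
  shows "\<nu> = \<mu>"
proof -
  have row: "(if i < length \<nu> then \<nu> ! i else 0) = (if i < length \<mu> then \<mu> ! i else 0)" for i
    using young_diagram_row[of i \<nu>] young_diagram_row[of i \<mu>]
    unfolding assms(3) by (simp only: lessThan_eq_iff)
  have pos: "\<nu> ! i > 0" if "i < length \<nu>" for i
    using assms(1) nth_mem[OF that] by (cases "\<nu> ! i") (simp_all add: integer_partition_def)
  have pos': "\<mu> ! i > 0" if "i < length \<mu>" for i
    using assms(2) nth_mem[OF that] by (cases "\<mu> ! i") (simp_all add: integer_partition_def)
  have "i < length \<nu> \<longleftrightarrow> i < length \<mu>" for i
    using row[of i] pos[of i] pos'[of i] by (cases "i < length \<nu>"; cases "i < length \<mu>") simp_all
  from this[of "length \<nu>"] this[of "length \<mu>"] have len: "length \<nu> = length \<mu>"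
    by simp
  show ?thesis
  proof (rule nth_equalityI[OF len])
    fix i assume "i < length \<nu>"
    with row[of i] len show "\<nu> ! i = \<mu> ! i" by simp
  qed
qed

text \<open>The sets counted by \<^const>\<open>num_svt\<close> and \<^const>\<open>bell\<close> are finite, so \<^const>\<open>card\<close> is
  a genuine count.\<close>

lemma finite_integer_partitions_le: "finite {\<nu>. integer_partition \<nu> \<and> sum_list \<nu> \<le> n}"
proof (rule finite_subset)
  show "{\<nu>. integer_partition \<nu> \<and> sum_list \<nu> \<le> n} \<subseteq> {\<nu>. set \<nu> \<subseteq> {..n} \<and> length \<nu> \<le> n}"
  proof safe
    fix \<nu> :: "nat list" and x assume "x \<in> set \<nu>" "sum_list \<nu> \<le> n"
    then show "x \<le> n" using member_le_sum_list[of x \<nu>] by simp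
  next
    fix \<nu> :: "nat list" assume "integer_partition \<nu>" "sum_list \<nu> \<le> n"
    moreover have "0 \<notin> set xs \<Longrightarrow> length xs \<le> sum_list xs" for xs :: "nat list"
      by (induction xs) auto
    ultimately show "length \<nu> \<le> n"
      unfolding integer_partition_def using le_trans by blast
  qed
  show "finite {\<nu>. set \<nu> \<subseteq> {..n} \<and> length \<nu> \<le> n}"
    by (rule finite_lists_length_le) simp
qed

lemma svt_size_le:
  assumes "simplified_vacillating_tableau k \<mu> T" "i < length T"
  shows "sum_list (T ! i) \<le> i"
  using assms(2)
proof (induction i)
  case 0
  then show ?case using assms(1) by (simp add: simplified_vacillating_tableau_def)
next
  case (Suc i)
  let ?A = "young_diagram (T ! i)" and ?B = "young_diagram (T ! Suc i)"
  have "card ?B \<le> Suc (card ?A)"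
  proof (cases "even i")
    case True
    then obtain j where "i = 2 * j" by blast
    moreover have "j \<le> k"
      using assms(1) Suc.prems \<open>i = 2 * j\<close> by (simp add: simplified_vacillating_tableau_def)
    ultimately have "?B \<subseteq> ?A"
      using assms(1) by (simp add: simplified_vacillating_tableau_def)
    then show ?thesis using card_mono[OF finite_young_diagram] le_SucI by blast
  next
    case False
    then obtain j where j: "i = 2 * j + 1" by (auto elim: oddE)
    have "j < k"
      using assms(1) Suc.prems j by (simp add: simplified_vacillating_tableau_def)
    then have "?A \<subseteq> ?B" and "card (?B - ?A) \<in> {0, 1}"
      using assms(1) j by (simp_all add: simplified_vacillating_tableau_def)
    then have "?A \<subseteq> ?B" "card (?B - ?A) \<le> 1"
      by auto
    then show ?thesis
      by (simp add: card_Diff_subset[OF finite_young_diagram])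
  qed
  with Suc show ?case by (simp add: card_young_diagram)
qed

lemma finite_svt: "finite {T. simplified_vacillating_tableau k \<mu> T}"
proof (rule finite_subset)
  let ?S = "{\<nu>. integer_partition \<nu> \<and> sum_list \<nu> \<le> 2 * k + 2}"
  show "{T. simplified_vacillating_tableau k \<mu> T} \<subseteq> {T. set T \<subseteq> ?S \<and> length T = 2 * k + 2}"
  proof safe
    fix T \<nu> assume T: "simplified_vacillating_tableau k \<mu> T" and "\<nu> \<in> set T"
    then show "integer_partition \<nu>" by (simp add: simplified_vacillating_tableau_def)
    from \<open>\<nu> \<in> set T\<close> obtain i where "i < length T" "T ! i = \<nu>" by (auto simp: in_set_conv_nth)
    moreover have "length T = 2 * k + 2" using T by (simp add: simplified_vacillating_tableau_def)
    ultimately show "sum_list \<nu> \<le> 2 * k + 2" using svt_size_le[OF T, of i] by simp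
  qed (simp add: simplified_vacillating_tableau_def)
  show "finite {T. set T \<subseteq> ?S \<and> length T = 2 * k + 2}"
    by (rule finite_lists_length_eq[OF finite_integer_partitions_le])
qed

lemma finite_set_partitions: "finite {P. partition_on {1..m::nat} P}"
  by (rule finitely_many_partition_on) simp

end

theory Submission
  imports Defs
begin

text \<open>
  Young's lattice is a differential poset. Let \<open>U\<close> send a function on partitions to its sum over
  the partitions with one box less, let \<open>D\<close> sum over the partitions with one box more, and let
  \<open>\<delta>\<close> be the indicator function of the empty partition. Then \<open>DU - UD = 1\<close> and \<open>D \<delta> = 0\<close>.
  A step of a vacillating tableau may also stand still, so counting tableaux means applying
  \<open>1 + D\<close> and \<open>1 + U\<close> in turn to \<open>\<delta>\<close>; these two operators are the ones called \<open>Down\<close> and \<open>Up\<close>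
  below, and they satisfy the same relation \<open>Down Up = Up Down + 1\<close>, now with
  \<open>Down \<delta> = \<delta>\<close> (lemmas \<open>Down_Up\<close> and \<open>Down_empty_indicator\<close>).

  Consequently \<open>Up Down (Up\<^sup>k \<delta>) = Up\<^sup>k\<^sup>+\<^sup>1 \<delta> + k Up\<^sup>k \<delta>\<close>. This is how the number of blocks of a set
  partition behaves when one more element is inserted: it forms a new block or joins one of the
  \<open>k\<close> old ones. By induction, \<open>(Up Down)\<^sup>n \<delta>\<close> is the sum of \<open>Up\<^sup>k \<delta>\<close> over all set partitions of
  \<open>{1..n}\<close>, where \<open>k\<close> is the number of blocks (lemma \<open>updown_iterate_conv_partitions\<close>). Each
  \<open>Up\<^sup>k \<delta>\<close> has value 1 at the empty partition, whence \<open>(Up Down)\<^sup>n \<delta>\<close> has value \<open>bell n\<close> there.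

  Finally \<open>num_svt k\<close> is \<open>Down ((Up Down)\<^sup>k \<delta>)\<close>, and \<open>Up\<close> and \<open>Down\<close> are adjoint for the pairing
  that sums products of values over all partitions. Moving operators across this pairing turns
  the sum in question into the value of \<open>(Up Down)\<^sup>n \<delta>\<close> at the empty partition, for
  \<open>n = k1 + k2 + 1\<close> (lemma \<open>sum_Down_updown_iterate\<close>).
\<close>

section \<open>Partitions as weakly decreasing functions\<close>

text \<open>Padding with zeros makes the row lengths a total function, so that adding a box is a
  function update and joins and meets of diagrams are pointwise maxima and minima.\<close>
definition row :: "nat list \<Rightarrow> nat \<Rightarrow> nat" where
  "row \<nu> i = (if i < length \<nu> then \<nu> ! i else 0)"

lemma young_diagram_conv_row: "young_diagram \<nu> = {(i, j). j < row \<nu> i}"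
  by (auto simp: young_diagram_def row_def split: if_splits)

lemma row_inj:
  assumes "integer_partition \<mu>" "integer_partition \<nu>" "row \<mu> = row \<nu>"
  shows "\<mu> = \<nu>"
  using assms young_diagram_inj by (simp add: young_diagram_conv_row)

lemma antimono_row:
  assumes "integer_partition \<nu>"
  shows "antimono (row \<nu>)"
proof (rule antimonoI)
  fix i j :: nat assume "i \<le> j"
  then show "row \<nu> j \<le> row \<nu> i"
    using assms by (cases "i = j") (auto simp: row_def integer_partition_def sorted_wrt_iff_nth_less)
qed

lemma partition_of_rows:
  assumes "antimono r" "r n = 0"
  obtains \<nu> where "integer_partition \<nu>" "row \<nu> = r"
proof
  define m where "m = (LEAST n. r n = 0)"
  have m: "r m = 0" unfolding m_def by (rule LeastI) (rule assms(2))
  have pos: "r i \<noteq> 0" if "i < m" for i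
    using not_less_Least that unfolding m_def by blast
  have zero: "r i = 0" if "\<not> i < m" for i
    using antimonoD[OF assms(1), of m i] that m by simp
  show "integer_partition (map r [0..<m])"
    using antimonoD[OF assms(1)] pos
    by (fastforce simp: integer_partition_def sorted_wrt_iff_nth_less)
  show "row (map r [0..<m]) = r"
    by (rule ext) (simp add: row_def zero)
qed

section \<open>Adding at most one box\<close>

text \<open>Equality is included because a tableau may repeat a partition. The neighbours of a
  partition, below, are meant in this weak sense.\<close>
definition grows :: "nat list \<Rightarrow> nat list \<Rightarrow> bool" where
  "grows \<kappa> \<mu> \<longleftrightarrow> integer_partition \<kappa> \<and> integer_partition \<mu> \<and>
     young_diagram \<kappa> \<subseteq> young_diagram \<mu> \<and> card (young_diagram \<mu> - young_diagram \<kappa>) \<in> {0, 1}"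

lemma grows_refl: "integer_partition \<mu> \<Longrightarrow> grows \<mu> \<mu>"
  by (simp add: grows_def)

lemma grows_card:
  "grows \<kappa> \<mu> \<longleftrightarrow> integer_partition \<kappa> \<and> integer_partition \<mu> \<and>
     young_diagram \<kappa> \<subseteq> young_diagram \<mu> \<and> card (young_diagram \<mu> - young_diagram \<kappa>) \<le> 1"
  by (auto simp: grows_def)

lemma grows_size:
  assumes "grows \<kappa> \<mu>"
  shows "sum_list \<kappa> \<le> sum_list \<mu>" "sum_list \<mu> \<le> Suc (sum_list \<kappa>)"
  using assms card_mono[OF finite_young_diagram[of \<mu>], of "young_diagram \<kappa>"]
    card_Diff_subset[OF finite_young_diagram[of \<kappa>], of "young_diagram \<mu>"]
  by (auto simp: grows_card card_young_diagram)

lemma finite_grows_to: "finite {\<kappa>. grows \<kappa> \<mu>}"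
  by (rule finite_subset[OF _ finite_integer_partitions_le[of "sum_list \<mu>"]])
     (use grows_size(1) in \<open>auto simp: grows_def\<close>)

lemma finite_grows_from: "finite {\<mu>. grows \<kappa> \<mu>}"
  by (rule finite_subset[OF _ finite_integer_partitions_le[of "Suc (sum_list \<kappa>)"]])
     (use grows_size(2) in \<open>auto simp: grows_def\<close>)

lemma grows_iff_row:
  "grows \<kappa> \<mu> \<longleftrightarrow> integer_partition \<kappa> \<and> integer_partition \<mu> \<and>
     (\<kappa> = \<mu> \<or> (\<exists>i. row \<mu> = (row \<kappa>)(i := Suc (row \<kappa> i))))"
proof (intro iffI conjI; (elim conjE)?)
  assume g: "grows \<kappa> \<mu>"
  then show ip: "integer_partition \<kappa>" "integer_partition \<mu>" by (simp_all add: grows_def)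
  from g have sub: "young_diagram \<kappa> \<subseteq> young_diagram \<mu>"
    and card: "card (young_diagram \<mu> - young_diagram \<kappa>) \<in> {0, 1}"
    by (simp_all add: grows_def)
  show "\<kappa> = \<mu> \<or> (\<exists>i. row \<mu> = (row \<kappa>)(i := Suc (row \<kappa> i)))"
  proof (cases "young_diagram \<mu> = young_diagram \<kappa>")
    case True
    then show ?thesis using young_diagram_inj ip by metis
  next
    case False
    with sub card have "card (young_diagram \<mu> - young_diagram \<kappa>) = 1"
      by (auto simp: finite_young_diagram)
    then obtain i j where ij: "young_diagram \<mu> - young_diagram \<kappa> = {(i, j)}"
      by (metis card_1_singletonE surj_pair)
    with sub have eq: "young_diagram \<mu> = insert (i, j) (young_diagram \<kappa>)" by blast
    have new: "(i, j) \<notin> young_diagram \<kappa>" using ij by blast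
    have "row \<mu> k = ((row \<kappa>)(i := Suc (row \<kappa> i))) k" for k
    proof -
      have "{..<row \<mu> k} = {l. (k, l) \<in> young_diagram \<mu>}"
        by (auto simp: young_diagram_conv_row)
      also have "\<dots> = (if k = i then insert j {..<row \<kappa> k} else {..<row \<kappa> k})"
        unfolding eq by (auto simp: young_diagram_conv_row)
      finally have "card {..<row \<mu> k} = card (if k = i then insert j {..<row \<kappa> k} else {..<row \<kappa> k})"
        by (rule arg_cong)
      then show ?thesis using new by (simp add: young_diagram_conv_row split: if_splits)
    qed
    then show ?thesis by blast
  qed
next
  assume ip: "integer_partition \<kappa>" "integer_partition \<mu>"
    and "\<kappa> = \<mu> \<or> (\<exists>i. row \<mu> = (row \<kappa>)(i := Suc (row \<kappa> i)))"
  then consider "\<kappa> = \<mu>" | i where "row \<mu> = (row \<kappa>)(i := Suc (row \<kappa> i))" by blast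
  then show "grows \<kappa> \<mu>"
  proof cases
    case 2
    have "young_diagram \<mu> = insert (i, row \<kappa> i) (young_diagram \<kappa>)"
      by (auto simp: young_diagram_conv_row 2 split: if_splits)
    then show ?thesis using ip by (auto simp: grows_def young_diagram_conv_row insert_Diff_if)
  qed (use ip grows_refl in simp)
qed

text \<open>A box can be removed from row \<open>i\<close> iff row \<open>i + 1\<close> is strictly shorter, and exactly then a
  box can be added to row \<open>i + 1\<close>. A box can also always be added to row 0, so there is one more
  way to add a box than to remove one. This is the diagonal part of the commutation relation.\<close>
lemma card_grows_from:
  assumes \<mu>: "integer_partition \<mu>"
  shows "card {\<kappa>. grows \<mu> \<kappa>} = Suc (card {\<kappa>. grows \<kappa> \<mu>})"
proof -
  define r where "r = row \<mu>"
  have r: "antimono r" unfolding r_def using \<mu> by (rule antimono_row)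
  have r0: "r i = 0" if "i \<ge> length \<mu>" for i using that by (simp add: r_def row_def)
  \<comment> \<open>\<open>R\<close> and \<open>A\<close> are the rows from which a box can be removed and to which one can be added.\<close>
  define R where "R = {i. r (Suc i) < r i}"
  define A where "A = insert 0 (Suc ` R)"
  have "R \<subseteq> {..<length \<mu>}"
  proof
    fix i assume "i \<in> R"
    then have "r i \<noteq> 0" by (simp add: R_def)
    then show "i \<in> {..<length \<mu>}" using r0[of i] by (auto simp: not_less[symmetric])
  qed
  then have "finite R" by (rule finite_subset) simp
  then have cardA: "card A = Suc (card R)"
    by (simp add: A_def card_image card_insert_if image_iff)
  define up where "up i = r(i := Suc (r i))" for i
  define dn where "dn i = r(i := r i - 1)" for i
  have row_mono: "row \<kappa> (Suc i) \<le> row \<kappa> i" if "integer_partition \<kappa>" for \<kappa> i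
    using antimonoD[OF antimono_row[OF that], of i "Suc i"] by simp
  have ups: "row ` ({\<kappa>. grows \<mu> \<kappa>} - {\<mu>}) = up ` A"
  proof (intro equalityI image_subsetI)
    fix \<kappa> assume "\<kappa> \<in> {\<kappa>. grows \<mu> \<kappa>} - {\<mu>}"
    then obtain i where ip: "integer_partition \<kappa>" and i: "row \<kappa> = up i"
      by (auto simp: grows_iff_row up_def r_def)
    have "i \<in> A"
    proof (cases i)
      case (Suc k)
      then show ?thesis using row_mono[OF ip, of k] by (simp add: i up_def A_def R_def)
    qed (simp add: A_def)
    then show "row \<kappa> \<in> up ` A" using i by blast
  next
    fix i assume i: "i \<in> A"
    have "antimono (up i)"
    proof (rule decseq_SucI)
      fix n show "up i (Suc n) \<le> up i n"
        using i antimonoD[OF r, of n "Suc n"] by (auto simp: up_def A_def R_def)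
    qed
    \<comment> \<open>any index that is beyond both the last row of \<open>\<mu>\<close> and the new box will do\<close>
    moreover have "up i (Suc (i + length \<mu>)) = 0"
      by (simp add: up_def r0)
    ultimately obtain \<kappa> where \<kappa>: "integer_partition \<kappa>" "row \<kappa> = up i"
      by (rule partition_of_rows)
    have "row \<kappa> i \<noteq> row \<mu> i" by (simp add: \<kappa> up_def r_def)
    then have "\<kappa> \<noteq> \<mu>" by blast
    moreover have "grows \<mu> \<kappa>"
      using \<mu> \<kappa> by (auto simp: grows_iff_row up_def r_def)
    ultimately show "up i \<in> row ` ({\<kappa>. grows \<mu> \<kappa>} - {\<mu>})"
      using \<kappa>(2) by (intro image_eqI[of _ _ \<kappa>]) auto
  qed
  have dns: "row ` ({\<kappa>. grows \<kappa> \<mu>} - {\<mu>}) = dn ` R"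
  proof (intro equalityI image_subsetI)
    fix \<kappa> assume "\<kappa> \<in> {\<kappa>. grows \<kappa> \<mu>} - {\<mu>}"
    then obtain i where ip: "integer_partition \<kappa>" and i: "r = (row \<kappa>)(i := Suc (row \<kappa> i))"
      by (auto simp: grows_iff_row r_def)
    have "i \<in> R" using row_mono[OF ip, of i] by (simp add: i R_def)
    moreover have "row \<kappa> = dn i" by (simp add: dn_def i)
    ultimately show "row \<kappa> \<in> dn ` R" by blast
  next
    fix i assume i: "i \<in> R"
    have "antimono (dn i)"
    proof (rule decseq_SucI)
      fix n show "dn i (Suc n) \<le> dn i n"
        using i antimonoD[OF r, of n "Suc n"] by (auto simp: dn_def R_def)
    qed
    moreover have "dn i (Suc (i + length \<mu>)) = 0"
      by (simp add: dn_def r0)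
    ultimately obtain \<kappa> where \<kappa>: "integer_partition \<kappa>" "row \<kappa> = dn i"
      by (rule partition_of_rows)
    have pos: "r i > 0" using i by (simp add: R_def)
    then have "row \<kappa> i \<noteq> row \<mu> i" by (simp add: \<kappa> dn_def r_def)
    then have "\<kappa> \<noteq> \<mu>" by blast
    moreover have "row \<mu> = (row \<kappa>)(i := Suc (row \<kappa> i))"
      using pos by (simp add: \<kappa> dn_def r_def)
    then have "grows \<kappa> \<mu>"
      using \<mu> \<kappa> by (auto simp: grows_iff_row)
    ultimately show "dn i \<in> row ` ({\<kappa>. grows \<kappa> \<mu>} - {\<mu>})"
      using \<kappa>(2) by (intro image_eqI[of _ _ \<kappa>]) auto
  qed
  have "inj_on row {\<nu>. integer_partition \<nu>}"
    by (auto intro!: inj_onI row_inj)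
  then have inj: "inj_on row ({\<kappa>. grows \<mu> \<kappa>} - {\<mu>})" "inj_on row ({\<kappa>. grows \<kappa> \<mu>} - {\<mu>})"
    by (auto elim!: inj_on_subset simp: grows_def)
  have "inj_on up A"
  proof (rule inj_onI, rule ccontr)
    fix i j assume "up i = up j" "i \<noteq> j"
    then have "up i i = up j i" by simp
    with \<open>i \<noteq> j\<close> show False by (simp add: up_def)
  qed
  moreover have "inj_on dn R"
  proof (rule inj_onI, rule ccontr)
    fix i j assume "i \<in> R" "dn i = dn j" "i \<noteq> j"
    then have "dn i i = dn j i" by simp
    with \<open>i \<in> R\<close> \<open>i \<noteq> j\<close> show False by (simp add: dn_def R_def)
  qed
  ultimately have "card ({\<kappa>. grows \<mu> \<kappa>} - {\<mu>}) = Suc (card ({\<kappa>. grows \<kappa> \<mu>} - {\<mu>}))"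
    using card_image[OF inj(1)] card_image[OF inj(2)] ups dns cardA by (simp add: card_image)
  moreover have "card {\<kappa>. grows \<mu> \<kappa>} = Suc (card ({\<kappa>. grows \<mu> \<kappa>} - {\<mu>}))"
    using finite_grows_from grows_refl[OF \<mu>] by (intro card.remove) auto
  moreover have "card {\<kappa>. grows \<kappa> \<mu>} = Suc (card ({\<kappa>. grows \<kappa> \<mu>} - {\<mu>}))"
    using finite_grows_to grows_refl[OF \<mu>] by (intro card.remove) auto
  ultimately show ?thesis by simp
qed

section \<open>Common neighbours of two partitions\<close>

lemma partition_union:
  assumes "integer_partition \<mu>" "integer_partition \<nu>"
  obtains \<kappa> where "integer_partition \<kappa>" "young_diagram \<kappa> = young_diagram \<mu> \<union> young_diagram \<nu>"
proof -
  have "antimono (\<lambda>i. max (row \<mu> i) (row \<nu> i))"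
    using assms[THEN antimono_row] by (auto simp: antimono_def intro: le_max_iff_disj[THEN iffD2])
  moreover have "max (row \<mu> (length \<mu> + length \<nu>)) (row \<nu> (length \<mu> + length \<nu>)) = 0"
    by (simp add: row_def)
  ultimately obtain \<kappa> where "integer_partition \<kappa>" "row \<kappa> = (\<lambda>i. max (row \<mu> i) (row \<nu> i))"
    by (rule partition_of_rows)
  then show thesis by (intro that[of \<kappa>]) (auto simp: young_diagram_conv_row)
qed

lemma partition_inter:
  assumes "integer_partition \<mu>" "integer_partition \<nu>"
  obtains \<kappa> where "integer_partition \<kappa>" "young_diagram \<kappa> = young_diagram \<mu> \<inter> young_diagram \<nu>"
proof -
  have "antimono (\<lambda>i. min (row \<mu> i) (row \<nu> i))"
    using assms[THEN antimono_row] by (auto simp: antimono_def intro: min_le_iff_disj[THEN iffD2])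
  moreover have "min (row \<mu> (length \<mu>)) (row \<nu> (length \<mu>)) = 0"
    by (simp add: row_def)
  ultimately obtain \<kappa> where "integer_partition \<kappa>" "row \<kappa> = (\<lambda>i. min (row \<mu> i) (row \<nu> i))"
    by (rule partition_of_rows)
  then show thesis by (intro that[of \<kappa>]) (auto simp: young_diagram_conv_row)
qed

text \<open>A further element of \<open>C\<close> outside \<open>A \<union> B\<close> would be the only element missing from \<open>A\<close> and
  also the only one missing from \<open>B\<close>, and then \<open>A\<close> and \<open>B\<close> would coincide.\<close>
lemma common_superset_is_union:
  assumes "finite C" "A \<noteq> B" "A \<subseteq> C" "B \<subseteq> C" "card (C - A) \<le> 1" "card (C - B) \<le> 1"
  shows "C = A \<union> B"
proof (rule ccontr)
  assume "C \<noteq> A \<union> B"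
  then obtain x where x: "x \<in> C - A" "x \<in> C - B" using assms(3,4) by blast
  have "C - A = {x}" "C - B = {x}"
    using x assms(1,5,6)
    by (metis card_le_Suc0_iff_eq finite_Diff One_nat_def is_singletonI'
        is_singleton_the_elem singletonD empty_iff)+
  then show False using assms(2,3,4) by blast
qed

lemma common_subset_is_inter:
  assumes "finite A" "finite B" "A \<noteq> B" "C \<subseteq> A" "C \<subseteq> B" "card (A - C) \<le> 1" "card (B - C) \<le> 1"
  shows "C = A \<inter> B"
proof (rule ccontr)
  assume "C \<noteq> A \<inter> B"
  then obtain x where x: "x \<in> A - C" "x \<in> B - C" using assms(4,5) by blast
  have "A - C = {x}" "B - C = {x}"
    using x assms(1,2,6,7)
    by (metis card_le_Suc0_iff_eq finite_Diff One_nat_def is_singletonI'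
        is_singleton_the_elem singletonD empty_iff)+
  then show False using assms(3-5) by blast
qed

text \<open>The only candidate above both partitions is their join and the only one below both is their
  meet. Each qualifies iff neither diagram has more than one box outside the other, because
  \<open>(A \<union> B) - A = B - A = B - (A \<inter> B)\<close>. This is the off-diagonal part of the commutation
  relation.\<close>
lemma card_common_grows:
  assumes ip: "integer_partition \<mu>" "integer_partition \<nu>" and neq: "\<mu> \<noteq> \<nu>"
  shows "card {\<kappa>. grows \<mu> \<kappa> \<and> grows \<nu> \<kappa>} = card {\<kappa>. grows \<kappa> \<mu> \<and> grows \<kappa> \<nu>}"
proof -
  let ?M = "young_diagram \<mu>" and ?N = "young_diagram \<nu>"
  have neq': "?M \<noteq> ?N" using young_diagram_inj[OF ip] neq by blast
  obtain u where u: "integer_partition u" "young_diagram u = ?M \<union> ?N"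
    using ip by (rule partition_union)
  obtain l where l: "integer_partition l" "young_diagram l = ?M \<inter> ?N"
    using ip by (rule partition_inter)
  let ?close = "card (?M - ?N) \<le> 1 \<and> card (?N - ?M) \<le> 1"
  have "{\<kappa>. grows \<mu> \<kappa> \<and> grows \<nu> \<kappa>} = (if ?close then {u} else {})"
  proof -
    have "\<kappa> = u" if "grows \<mu> \<kappa>" "grows \<nu> \<kappa>" for \<kappa>
      using that common_superset_is_union[OF finite_young_diagram neq', of \<kappa>] u young_diagram_inj[of \<kappa> u]
      by (auto simp: grows_card)
    moreover have "grows \<mu> u \<and> grows \<nu> u \<longleftrightarrow> ?close"
      using ip u by (auto simp: grows_card Un_Diff)
    ultimately show ?thesis by auto
  qed
  moreover have "{\<kappa>. grows \<kappa> \<mu> \<and> grows \<kappa> \<nu>} = (if ?close then {l} else {})"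
  proof -
    have "\<kappa> = l" if "grows \<kappa> \<mu>" "grows \<kappa> \<nu>" for \<kappa>
      using that common_subset_is_inter[OF finite_young_diagram finite_young_diagram neq', of "young_diagram \<kappa>"]
        l young_diagram_inj[of \<kappa> l]
      by (auto simp: grows_card)
    moreover have "grows l \<mu> \<and> grows l \<nu> \<longleftrightarrow> ?close"
      using ip l by (auto simp: grows_card Diff_Int)
    ultimately show ?thesis by auto
  qed
  ultimately show ?thesis by simp
qed

section \<open>The operators Up and Down\<close>

definition Up :: "(nat list \<Rightarrow> nat) \<Rightarrow> nat list \<Rightarrow> nat" where
  "Up f \<mu> = (\<Sum>\<kappa> | grows \<kappa> \<mu>. f \<kappa>)"

definition Down :: "(nat list \<Rightarrow> nat) \<Rightarrow> nat list \<Rightarrow> nat" where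
  "Down f \<mu> = (\<Sum>\<kappa> | grows \<mu> \<kappa>. f \<kappa>)"

lemma Up_cong: "(\<And>\<kappa>. integer_partition \<kappa> \<Longrightarrow> f \<kappa> = g \<kappa>) \<Longrightarrow> Up f \<mu> = Up g \<mu>"
  unfolding Up_def by (rule sum.cong) (auto simp: grows_def)

lemma Down_cong: "(\<And>\<kappa>. integer_partition \<kappa> \<Longrightarrow> f \<kappa> = g \<kappa>) \<Longrightarrow> Down f \<mu> = Down g \<mu>"
  unfolding Down_def by (rule sum.cong) (auto simp: grows_def)

lemma Up_add: "Up (\<lambda>\<kappa>. f \<kappa> + g \<kappa>) \<mu> = Up f \<mu> + Up g \<mu>"
  by (simp add: Up_def sum.distrib)

lemma Up_sum: "Up (\<lambda>\<kappa>. \<Sum>i\<in>I. f i \<kappa>) \<mu> = (\<Sum>i\<in>I. Up (f i) \<mu>)"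
  unfolding Up_def by (rule sum.swap)

lemma Down_sum: "Down (\<lambda>\<kappa>. \<Sum>i\<in>I. f i \<kappa>) \<mu> = (\<Sum>i\<in>I. Down (f i) \<mu>)"
  unfolding Down_def by (rule sum.swap)

lemma Up_scale: "Up (\<lambda>\<kappa>. c * f \<kappa>) \<mu> = c * Up f \<mu>"
  by (simp add: Up_def sum_distrib_left)

text \<open>Both sides expand into a sum of values \<open>f \<nu>\<close> over the partitions \<open>\<nu>\<close> that are within one
  box of some neighbour of \<open>\<mu>\<close>. The coefficient of \<open>f \<nu>\<close> counts the common upper neighbours of
  \<open>\<mu>\<close> and \<open>\<nu>\<close> on the left and the common lower ones on the right; these counts agree for
  \<open>\<nu> \<noteq> \<mu>\<close> and differ by one for \<open>\<nu> = \<mu>\<close>.\<close>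
lemma Down_Up:
  assumes \<mu>: "integer_partition \<mu>"
  shows "Down (Up f) \<mu> = Up (Down f) \<mu> + f \<mu>"
proof -
  \<comment> \<open>a finite set that contains every \<open>\<nu>\<close> reachable from \<open>\<mu>\<close> by an up and a down step in either order\<close>
  define F where "F = {\<nu>. integer_partition \<nu> \<and> sum_list \<nu> \<le> Suc (sum_list \<mu>)}"
  have finF: "finite F" unfolding F_def by (rule finite_integer_partitions_le)
  define c where "c \<nu> = card {\<kappa>. grows \<mu> \<kappa> \<and> grows \<nu> \<kappa>}" for \<nu>
  define d where "d \<nu> = card {\<kappa>. grows \<kappa> \<mu> \<and> grows \<kappa> \<nu>}" for \<nu>
  have \<mu>F: "\<mu> \<in> F" using \<mu> by (simp add: F_def)
  have "Down (Up f) \<mu> = (\<Sum>\<kappa> | grows \<mu> \<kappa>. \<Sum>\<nu>\<in>F. if grows \<nu> \<kappa> then f \<nu> else 0)"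
    unfolding Down_def Up_def
  proof (rule sum.cong[OF refl])
    fix \<kappa> assume "\<kappa> \<in> {\<kappa>. grows \<mu> \<kappa>}"
    then have "{\<nu>. grows \<nu> \<kappa>} = {\<nu> \<in> F. grows \<nu> \<kappa>}"
      using grows_size(2)[of \<mu> \<kappa>] grows_size(1)[of _ \<kappa>] by (fastforce simp: F_def grows_def)
    then show "(\<Sum>\<nu> | grows \<nu> \<kappa>. f \<nu>) = (\<Sum>\<nu>\<in>F. if grows \<nu> \<kappa> then f \<nu> else 0)"
      using finF by (simp add: sum.inter_filter)
  qed
  also have "\<dots> = (\<Sum>\<nu>\<in>F. \<Sum>\<kappa> | grows \<mu> \<kappa>. if grows \<nu> \<kappa> then f \<nu> else 0)"
    by (rule sum.swap)
  also have "\<dots> = (\<Sum>\<nu>\<in>F. c \<nu> * f \<nu>)"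
    by (simp add: c_def finite_grows_from flip: sum.inter_filter)
  finally have DU: "Down (Up f) \<mu> = (\<Sum>\<nu>\<in>F. c \<nu> * f \<nu>)" .
  have "Up (Down f) \<mu> = (\<Sum>\<kappa> | grows \<kappa> \<mu>. \<Sum>\<nu>\<in>F. if grows \<kappa> \<nu> then f \<nu> else 0)"
    unfolding Down_def Up_def
  proof (rule sum.cong[OF refl])
    fix \<kappa> assume "\<kappa> \<in> {\<kappa>. grows \<kappa> \<mu>}"
    then have "{\<nu>. grows \<kappa> \<nu>} = {\<nu> \<in> F. grows \<kappa> \<nu>}"
      using grows_size(1)[of \<kappa> \<mu>] grows_size(2)[of \<kappa>] by (fastforce simp: F_def grows_def)
    then show "(\<Sum>\<nu> | grows \<kappa> \<nu>. f \<nu>) = (\<Sum>\<nu>\<in>F. if grows \<kappa> \<nu> then f \<nu> else 0)"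
      using finF by (simp add: sum.inter_filter)
  qed
  also have "\<dots> = (\<Sum>\<nu>\<in>F. \<Sum>\<kappa> | grows \<kappa> \<mu>. if grows \<kappa> \<nu> then f \<nu> else 0)"
    by (rule sum.swap)
  also have "\<dots> = (\<Sum>\<nu>\<in>F. d \<nu> * f \<nu>)"
    by (simp add: d_def finite_grows_to flip: sum.inter_filter)
  finally have UD: "Up (Down f) \<mu> = (\<Sum>\<nu>\<in>F. d \<nu> * f \<nu>)" .
  have "c \<mu> = Suc (d \<mu>)"
    using card_grows_from[OF \<mu>] by (simp add: c_def d_def)
  moreover have "c \<nu> = d \<nu>" if "\<nu> \<in> F - {\<mu>}" for \<nu>
    using card_common_grows[OF \<mu>, of \<nu>] that by (auto simp: c_def d_def F_def)
  ultimately show ?thesis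
    unfolding DU UD by (simp add: sum.remove[OF finF \<mu>F])
qed

text \<open>The matrices of the two operators are transposes of each other; summing over a finite
  set that contains both supports replaces the pairing over all partitions.\<close>
lemma Up_Down_adjoint:
  assumes "finite F" "\<And>\<kappa>. f \<kappa> \<noteq> 0 \<Longrightarrow> \<kappa> \<in> F" "\<And>\<kappa>. g \<kappa> \<noteq> 0 \<Longrightarrow> \<kappa> \<in> F"
  shows "(\<Sum>\<mu>\<in>F. Down f \<mu> * g \<mu>) = (\<Sum>\<mu>\<in>F. f \<mu> * Up g \<mu>)"
proof -
  have "Down f \<mu> = (\<Sum>\<kappa>\<in>F. if grows \<mu> \<kappa> then f \<kappa> else 0)" for \<mu>
    unfolding Down_def using assms finite_grows_from
    by (auto simp flip: sum.inter_filter intro!: sum.mono_neutral_right)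
  moreover have "Up g \<kappa> = (\<Sum>\<mu>\<in>F. if grows \<mu> \<kappa> then g \<mu> else 0)" for \<kappa>
    unfolding Up_def using assms finite_grows_to
    by (auto simp flip: sum.inter_filter intro!: sum.mono_neutral_right)
  ultimately have L: "(\<Sum>\<mu>\<in>F. Down f \<mu> * g \<mu>) = (\<Sum>\<mu>\<in>F. \<Sum>\<kappa>\<in>F. if grows \<mu> \<kappa> then f \<kappa> * g \<mu> else 0)"
    and R: "(\<Sum>\<mu>\<in>F. f \<mu> * Up g \<mu>) = (\<Sum>\<kappa>\<in>F. \<Sum>\<mu>\<in>F. if grows \<mu> \<kappa> then f \<kappa> * g \<mu> else 0)"
    by (simp_all add: sum_distrib_left sum_distrib_right if_distrib if_distribR cong: if_cong)
  show ?thesis unfolding L R by (rule sum.swap)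
qed

section \<open>Iterating the operators on the empty partition\<close>

definition empty_indicator :: "nat list \<Rightarrow> nat" where
  "empty_indicator \<mu> = (if \<mu> = [] then 1 else 0)"

lemma integer_partition_Nil: "integer_partition []"
  by (simp add: integer_partition_def)

lemma young_diagram_Nil: "young_diagram [] = {}"
  by (simp add: young_diagram_def)

lemma grows_Nil_iff: "grows \<mu> [] \<longleftrightarrow> \<mu> = []"
  using young_diagram_inj[of \<mu> "[]"] integer_partition_Nil
  by (auto simp: grows_def young_diagram_Nil)

lemma Up_Nil: "Up f [] = f []"
  by (simp add: Up_def grows_Nil_iff)

lemma Down_empty_indicator: "Down empty_indicator = empty_indicator"
proof
  fix \<mu>
  have "Down empty_indicator \<mu> = (\<Sum>\<kappa> | grows \<mu> \<kappa>. if \<kappa> = [] then 1 else 0)"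
    by (simp add: Down_def empty_indicator_def)
  also have "\<dots> = (if grows \<mu> [] then 1 else 0)"
    using finite_grows_from by simp
  finally show "Down empty_indicator \<mu> = empty_indicator \<mu>" by (simp add: empty_indicator_def grows_Nil_iff)
qed

text \<open>By \<open>Down Up = Up Down + 1\<close>, \<open>Down\<close> acts on a polynomial in \<open>Up\<close> as 1 plus the derivative,
  once it has reached \<open>empty_indicator\<close>, which it fixes.\<close>
lemma Down_Up_power_empty_indicator:
  assumes "integer_partition \<mu>"
  shows "Down ((Up ^^ k) empty_indicator) \<mu>
       = (Up ^^ k) empty_indicator \<mu> + k * (Up ^^ (k - 1)) empty_indicator \<mu>"
  using assms
proof (induction k arbitrary: \<mu>)
  case 0
  then show ?case by (simp add: Down_empty_indicator)
next
  case (Suc k)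
  have "Down ((Up ^^ Suc k) empty_indicator) \<mu>
      = Up (Down ((Up ^^ k) empty_indicator)) \<mu> + (Up ^^ k) empty_indicator \<mu>"
    using Down_Up[OF Suc.prems] by simp
  also have "Up (Down ((Up ^^ k) empty_indicator)) \<mu>
      = Up (\<lambda>\<kappa>. (Up ^^ k) empty_indicator \<kappa> + k * (Up ^^ (k - 1)) empty_indicator \<kappa>) \<mu>"
    by (rule Up_cong) (rule Suc.IH)
  also have "\<dots> = (Up ^^ Suc k) empty_indicator \<mu> + k * (Up ^^ k) empty_indicator \<mu>"
    by (cases k) (simp_all add: Up_add Up_scale)
  finally show ?case by simp
qed

text \<open>Inserting a new element \<open>a\<close> into a set partition \<open>P\<close> of \<open>A\<close> means to choose the block that
  it joins, or to open a new one. The latter is treated as joining the empty set, so a single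
  map on pairs \<open>(P, B)\<close> with \<open>B \<in> insert {} P\<close> describes every set partition of \<open>insert a A\<close>
  exactly once. The weight \<open>\<phi>\<close> is arbitrary because the recursion is to be matched with powers of
  an operator, not only with numbers of partitions.\<close>
lemma sum_partition_on_insert:
  fixes \<phi> :: "nat \<Rightarrow> nat"
  assumes "finite A" "a \<notin> A"
  shows "(\<Sum>Q | partition_on (insert a A) Q. \<phi> (card Q))
       = (\<Sum>P | partition_on A P. \<phi> (Suc (card P)) + card P * \<phi> (card P))"
proof -
  let ?S = "SIGMA P:{P. partition_on A P}. insert {} P"
  let ?join = "\<lambda>(P, B). insert (insert a B) (P - {B})"
  have fin: "finite P" if "partition_on A P" for P
    using assms(1) that by (rule finite_elements)
  have sub: "B \<subseteq> A" if "(P, B) \<in> ?S" for P B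
    using that by (auto simp: partition_on_def)
  have inj: "inj_on ?join ?S"
  proof (rule inj_onI, clarify)
    fix P B P' B'
    assume P: "partition_on A P" and B: "B \<in> insert {} P"
      and P': "partition_on A P'" and B': "B' \<in> insert {} P'"
      and eq: "insert (insert a B) (P - {B}) = insert (insert a B') (P' - {B'})"
    have notin: "a \<notin> \<Union>P" "a \<notin> \<Union>P'" using P P' assms(2) by (auto simp: partition_on_def)
    have "insert a B \<in> insert (insert a B') (P' - {B'})" using eq by blast
    then have "insert a B = insert a B'" using notin by blast
    moreover have "a \<notin> B" "a \<notin> B'" using notin B B' by auto
    ultimately have BB: "B = B'" by (metis insert_ident)
    have "insert a B \<notin> P - {B}" "insert a B \<notin> P' - {B}" using notin by auto
    then have "P - {B} = P' - {B}" using eq unfolding BB[symmetric] by (rule insert_ident[THEN iffD1])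
    moreover have "{} \<notin> P" "{} \<notin> P'" using P P' by (auto simp: partition_on_def)
    ultimately have "P = P'" using B B' BB by blast
    with BB show "P = P' \<and> B = B'" by simp
  qed
  have "?join ` ?S = {Q. partition_on (insert a A) Q}"
  proof (intro equalityI subsetI)
    fix Q assume "Q \<in> ?join ` ?S"
    then obtain P B where Q: "Q = insert (insert a B) (P - {B})"
      and P: "partition_on A P" and B: "B \<in> insert {} P" by auto
    have "B \<subseteq> A" using sub P B by auto
    have disj: "disjnt X Y" if "X \<in> P" "Y \<in> P" "X \<noteq> Y" for X Y
      using P that by (auto simp: partition_on_def pairwise_def)
    have U: "\<Union>P = A" "{} \<notin> P" using P by (auto simp: partition_on_def)
    show "Q \<in> {Q. partition_on (insert a A) Q}"
    proof (rule CollectI, rule partition_onI)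
      show "\<Union>Q = insert a A" using U B by (auto simp: Q)
      show "{} \<notin> Q" using U by (auto simp: Q)
      fix X Y assume "X \<in> Q" "Y \<in> Q" "X \<noteq> Y"
      moreover have "disjnt (insert a B) X" if "X \<in> P - {B}" for X
        using that disj[of B X] B U assms(2) by auto
      ultimately show "disjnt X Y"
        using disj unfolding Q by (metis DiffD1 disjnt_sym insert_iff)
    qed
  next
    fix Q assume "Q \<in> {Q. partition_on (insert a A) Q}"
    then have Q: "partition_on (insert a A) Q" by simp
    then obtain X where X: "X \<in> Q" "a \<in> X" by (auto simp: partition_on_def)
    \<comment> \<open>Take \<open>a\<close> out of its block \<open>X\<close>; if nothing is left, the block disappears.\<close>
    define B where "B = X - {a}"
    define R where "R = Q - {X}"
    have Q_eq: "Q = insert X R" using X by (auto simp: R_def)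
    have dis: "X \<inter> Y = {}" if "Y \<in> R" for Y
      using Q that X(1) by (auto simp: R_def partition_on_def disjoint_def)
    then have disj: "disjnt X (\<Union>R)" by (auto simp: disjnt_def)
    then have R: "partition_on (insert a A - X) R" and XA: "X \<subseteq> insert a A"
      using Q partition_on_insert[of X R "insert a A"] unfolding Q_eq by auto
    have AB: "insert a A - X = A - B" "B \<subseteq> A" using X(2) XA assms(2) by (auto simp: B_def)
    have neR: "{} \<notin> R" using R by (auto simp: partition_on_def)
    have BR: "B \<notin> R"
    proof
      assume "B \<in> R"
      then have "X \<inter> B = {}" by (rule dis)
      then have "B = {}" unfolding B_def by blast
      with \<open>B \<in> R\<close> neR show False by simp
    qed
    let ?P = "insert B R - {{}}"
    have "partition_on A ?P"
    proof (cases "B = {}")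
      case True
      then show ?thesis using R AB neR by (simp add: insert_Diff_if)
    next
      case False
      moreover have "disjnt B (\<Union>R)" using disj by (auto simp: disjnt_def B_def)
      ultimately have "partition_on A (insert B R)" using R AB partition_on_insert by metis
      then show ?thesis using False neR by (simp add: insert_Diff_if)
    qed
    moreover have "insert (insert a B) (?P - {B}) = Q"
      using X(2) neR BR by (auto simp: Q_eq B_def insert_absorb)
    ultimately show "Q \<in> ?join ` ?S"
      by (intro image_eqI[of _ _ "(?P, B)"]) auto
  qed
  then have "(\<Sum>Q | partition_on (insert a A) Q. \<phi> (card Q)) = (\<Sum>PB\<in>?S. \<phi> (card (?join PB)))"
    using sum.reindex[OF inj, of "\<lambda>Q. \<phi> (card Q)"] by simp
  also have "\<dots> = (\<Sum>P | partition_on A P. \<Sum>B\<in>insert {} P. \<phi> (card (?join (P, B))))"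
    using finitely_many_partition_on[OF assms(1)] fin by (subst sum.Sigma) (auto simp: case_prod_unfold)
  also have "\<dots> = (\<Sum>P | partition_on A P. \<phi> (Suc (card P)) + card P * \<phi> (card P))"
  proof (rule sum.cong[OF refl])
    fix P assume "P \<in> {P. partition_on A P}"
    then have P: "partition_on A P" by simp
    have "a \<notin> X" if "X \<in> P" for X using P assms(2) that by (auto simp: partition_on_def)
    then have notin: "insert a B \<notin> P" for B by blast
    have ne: "{} \<notin> P" using P by (simp add: partition_on_def)
    have "card (insert (insert a B) (P - {B})) = card P" if "B \<in> P" for B
      using that notin[of B] fin[OF P] card.remove[of P B] by (simp add: card_insert_disjoint)
    then have "(\<Sum>B\<in>P. \<phi> (card (?join (P, B)))) = (\<Sum>B\<in>P. \<phi> (card P))"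
      by (intro sum.cong refl) (simp only: prod.case)
    moreover have "card (?join (P, {})) = Suc (card P)"
    proof -
      have "P - {{}} = P" using ne by blast
      then show ?thesis using notin[of "{}"] fin[OF P] by (simp add: card_insert_disjoint)
    qed
    moreover have "(\<Sum>B\<in>insert {} P. \<phi> (card (?join (P, B))))
        = \<phi> (card (?join (P, {}))) + (\<Sum>B\<in>P. \<phi> (card (?join (P, B))))"
      by (rule sum.insert) (use ne fin[OF P] in auto)
    ultimately show "(\<Sum>B\<in>insert {} P. \<phi> (card (?join (P, B))))
        = \<phi> (Suc (card P)) + card P * \<phi> (card P)"
      by (simp only: sum_constant of_nat_id)
  qed
  finally show ?thesis .
qed

section \<open>Tableau counts and Bell numbers\<close>

definition updown_iterate :: "nat \<Rightarrow> nat list \<Rightarrow> nat" where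
  "updown_iterate n = ((Up \<circ> Down) ^^ n) empty_indicator"

lemma updown_iterate_0: "updown_iterate 0 = empty_indicator"
  by (simp add: updown_iterate_def)

lemma updown_iterate_Suc: "updown_iterate (Suc n) = Up (Down (updown_iterate n))"
  by (simp add: updown_iterate_def)

text \<open>Applying \<open>Up \<circ> Down\<close> to \<open>Up\<^sup>k\<close> of \<open>empty_indicator\<close> yields \<open>Up\<^sup>k\<^sup>+\<^sup>1\<close> once and \<open>Up\<^sup>k\<close>
  with multiplicity \<open>k\<close>, in agreement with the insertion of \<open>n + 1\<close> into a set partition of
  \<open>{1..n}\<close> with \<open>k\<close> blocks.\<close>
lemma updown_iterate_conv_partitions:
  assumes "integer_partition \<mu>"
  shows "updown_iterate n \<mu> = (\<Sum>P | partition_on {1..n} P. (Up ^^ card P) empty_indicator \<mu>)"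
  using assms
proof (induction n arbitrary: \<mu>)
  case 0
  then show ?case by (simp add: updown_iterate_0 partition_on_empty)
next
  case (Suc n)
  have "updown_iterate (Suc n) \<mu> = Up (\<lambda>\<kappa>. \<Sum>P | partition_on {1..n} P. Down ((Up ^^ card P) empty_indicator) \<kappa>) \<mu>"
    unfolding updown_iterate_Suc Down_sum[symmetric] by (intro Up_cong Down_cong Suc.IH)
  also have "\<dots> = Up (\<lambda>\<kappa>. \<Sum>P | partition_on {1..n} P.
      (Up ^^ card P) empty_indicator \<kappa> + card P * (Up ^^ (card P - 1)) empty_indicator \<kappa>) \<mu>"
    by (intro Up_cong sum.cong refl Down_Up_power_empty_indicator)
  also have "\<dots> = (\<Sum>P | partition_on {1..n} P.
      (Up ^^ Suc (card P)) empty_indicator \<mu> + card P * Up ((Up ^^ (card P - 1)) empty_indicator) \<mu>)"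
    by (simp add: Up_sum Up_add Up_scale)
  also have "\<dots> = (\<Sum>P | partition_on {1..n} P.
      (Up ^^ Suc (card P)) empty_indicator \<mu> + card P * (Up ^^ card P) empty_indicator \<mu>)"
  proof (rule sum.cong[OF refl])
    \<comment> \<open>for \<open>card P = 0\<close> the truncated exponent \<open>card P - 1\<close> is wrong, but its coefficient vanishes\<close>
    fix P
    show "(Up ^^ Suc (card P)) empty_indicator \<mu> + card P * Up ((Up ^^ (card P - 1)) empty_indicator) \<mu>
        = (Up ^^ Suc (card P)) empty_indicator \<mu> + card P * (Up ^^ card P) empty_indicator \<mu>"
      by (cases "card P") simp_all
  qed
  also have "\<dots> = (\<Sum>P | partition_on {1..Suc n} P. (Up ^^ card P) empty_indicator \<mu>)"
    using sum_partition_on_insert[of "{1..n}" "Suc n" "\<lambda>k. (Up ^^ k) empty_indicator \<mu>"]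
    by (simp add: atLeastAtMostSuc_conv)
  finally show ?case .
qed

lemma updown_iterate_Nil: "updown_iterate n [] = bell n"
proof -
  have "(Up ^^ k) empty_indicator [] = 1" for k
    by (induction k) (simp_all add: empty_indicator_def Up_Nil)
  then show ?thesis by (simp add: updown_iterate_conv_partitions[OF integer_partition_Nil] bell_def)
qed

lemma updown_iterate_support: "updown_iterate n \<mu> \<noteq> 0 \<Longrightarrow> integer_partition \<mu> \<and> sum_list \<mu> \<le> n"
  and Down_updown_iterate_support: "Down (updown_iterate n) \<mu> \<noteq> 0 \<Longrightarrow> integer_partition \<mu> \<and> sum_list \<mu> \<le> n"
proof -
  have dn: "integer_partition \<mu> \<and> sum_list \<mu> \<le> m"
    if supp: "\<And>\<mu>. f \<mu> \<noteq> 0 \<Longrightarrow> sum_list \<mu> \<le> m" and nz: "Down f \<mu> \<noteq> 0" for f m \<mu>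
  proof -
    obtain \<kappa> where "grows \<mu> \<kappa>" "f \<kappa> \<noteq> 0"
      using nz sum.not_neutral_contains_not_neutral unfolding Down_def by blast
    then show ?thesis using supp grows_size(1) by (auto simp: grows_def intro: le_trans)
  qed
  have up: "integer_partition \<mu> \<and> sum_list \<mu> \<le> Suc m"
    if supp: "\<And>\<mu>. f \<mu> \<noteq> 0 \<Longrightarrow> sum_list \<mu> \<le> m" and nz: "Up f \<mu> \<noteq> 0" for f m \<mu>
  proof -
    obtain \<kappa> where "grows \<kappa> \<mu>" "f \<kappa> \<noteq> 0"
      using nz sum.not_neutral_contains_not_neutral unfolding Up_def by blast
    then show ?thesis using supp grows_size(2) by (fastforce simp: grows_def)
  qed
  have *: "updown_iterate n \<mu> \<noteq> 0 \<Longrightarrow> integer_partition \<mu> \<and> sum_list \<mu> \<le> n" for \<mu> n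
  proof (induction n arbitrary: \<mu>)
    case 0
    then show ?case by (simp add: updown_iterate_0 empty_indicator_def integer_partition_Nil split: if_splits)
  next
    case (Suc n)
    then show ?case using up[of "Down (updown_iterate n)" n \<mu>] dn[of "updown_iterate n" n] by (simp add: updown_iterate_Suc)
  qed
  show "updown_iterate n \<mu> \<noteq> 0 \<Longrightarrow> integer_partition \<mu> \<and> sum_list \<mu> \<le> n" by (rule *)
  show "Down (updown_iterate n) \<mu> \<noteq> 0 \<Longrightarrow> integer_partition \<mu> \<and> sum_list \<mu> \<le> n"
    using dn[of "updown_iterate n" n \<mu>] * by blast
qed

text \<open>By adjointness, the pairing of \<open>Down\<close> of the \<open>a\<close>-th and \<open>Down\<close> of the \<open>b\<close>-th iterate is the
  pairing of the \<open>a\<close>-th with the \<open>(b + 1)\<close>-st iterate and, by symmetry, also that of the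
  \<open>(a + 1)\<close>-st with the \<open>b\<close>-th. So only \<open>a + b\<close> matters, and for \<open>a = 0\<close> pairing with
  \<open>empty_indicator\<close> reads off the value at the empty partition. Of the iterates in question,
  the one with the largest index has index at most \<open>k1 + k2 + 1\<close>, so \<open>F\<close> contains all supports.\<close>
lemma sum_Down_updown_iterate:
  assumes F: "F = {\<nu>. integer_partition \<nu> \<and> sum_list \<nu> \<le> N}" and N: "k1 + k2 < N"
  shows "(\<Sum>\<mu>\<in>F. Down (updown_iterate k1) \<mu> * Down (updown_iterate k2) \<mu>) = updown_iterate (k1 + k2 + 1) []"
  using N
proof (induction k1 arbitrary: k2)
  have fin: "finite F" unfolding F by (rule finite_integer_partitions_le)
  have right: "(\<Sum>\<mu>\<in>F. Down (updown_iterate a) \<mu> * Down (updown_iterate b) \<mu>)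
      = (\<Sum>\<mu>\<in>F. updown_iterate a \<mu> * updown_iterate (Suc b) \<mu>)"
    if "a \<le> N" "b \<le> N" for a b
    unfolding updown_iterate_Suc using that fin
    using updown_iterate_support[of a] Down_updown_iterate_support[of b] by (intro Up_Down_adjoint) (fastforce simp: F)+
  {
    case 0
    have "(\<Sum>\<mu>\<in>F. updown_iterate 0 \<mu> * updown_iterate (Suc k2) \<mu>)
        = (\<Sum>\<mu>\<in>F. if \<mu> = [] then updown_iterate (Suc k2) \<mu> else 0)"
      by (intro sum.cong) (simp_all add: updown_iterate_0 empty_indicator_def)
    also have "\<dots> = updown_iterate (Suc k2) []"
      using fin by (simp add: F integer_partition_Nil)
    finally show ?case using right[of 0 k2] 0 by simp
  next
    case (Suc k1)
    have "(\<Sum>\<mu>\<in>F. Down (updown_iterate (Suc k1)) \<mu> * Down (updown_iterate k2) \<mu>)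
        = (\<Sum>\<mu>\<in>F. updown_iterate (Suc k1) \<mu> * updown_iterate (Suc k2) \<mu>)"
      using Suc.prems by (intro right) auto
    also have "\<dots> = (\<Sum>\<mu>\<in>F. Down (updown_iterate (Suc k2)) \<mu> * Down (updown_iterate k1) \<mu>)"
      using right[of "Suc k2" k1] Suc.prems by (simp add: mult.commute)
    also have "\<dots> = updown_iterate (Suc k1 + k2 + 1) []"
      using Suc.IH[of "Suc k2"] Suc.prems by (simp add: mult.commute)
    finally show ?case .
  }
qed

section \<open>Tableaux as walks\<close>

text \<open>The indices are those of the list encoding of a tableau: index \<open>i\<close> stands for the
  half-integer \<open>i / 2\<close>, so that the steps out of even positions may remove a box and those out of
  odd positions may add one.\<close>

definition step :: "nat \<Rightarrow> nat list \<Rightarrow> nat list \<Rightarrow> bool" where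
  "step i \<kappa> \<mu> \<longleftrightarrow> (if even i then grows \<mu> \<kappa> else grows \<kappa> \<mu>)"

text \<open>Unlike simplified vacillating tableaux, walks may have any number of steps, so that they can
  be counted by removing the last step.\<close>
definition walks :: "nat \<Rightarrow> nat list \<Rightarrow> nat list list set" where
  "walks n \<mu> = {T. length T = Suc n \<and> T ! 0 = [] \<and> T ! n = \<mu> \<and>
     (\<forall>i<n. step i (T ! i) (T ! Suc i))}"

lemma walks_0: "walks 0 \<mu> = (if \<mu> = [] then {[[]]} else {})"
  by (auto simp: walks_def length_Suc_conv)

lemma walks_Suc: "walks (Suc n) \<mu> = (\<Union>\<kappa>\<in>{\<kappa>. step n \<kappa> \<mu>}. (\<lambda>T. T @ [\<mu>]) ` walks n \<kappa>)"
proof (intro equalityI subsetI)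
  fix T assume T: "T \<in> walks (Suc n) \<mu>"
  then have "T \<noteq> []" by (auto simp: walks_def)
  then obtain S x where S: "T = S @ [x]" by (metis rev_exhaust)
  with T have len: "length S = Suc n" by (simp add: walks_def)
  have "x = \<mu>" using T len by (simp add: walks_def S nth_append)
  have st: "step i (T ! i) (T ! Suc i)" if "i \<le> n" for i
    using T that by (simp add: walks_def)
  have "step i (S ! i) (S ! Suc i)" if "i < n" for i
    using st[of i] that len by (simp add: S nth_append)
  then have "S \<in> walks n (S ! n)"
    using T len by (simp add: walks_def S nth_append)
  moreover have "step n (S ! n) \<mu>"
    using st[of n] len \<open>x = \<mu>\<close> by (simp add: S nth_append)
  ultimately show "T \<in> (\<Union>\<kappa>\<in>{\<kappa>. step n \<kappa> \<mu>}. (\<lambda>T. T @ [\<mu>]) ` walks n \<kappa>)"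
    using S \<open>x = \<mu>\<close> by blast
next
  fix T assume "T \<in> (\<Union>\<kappa>\<in>{\<kappa>. step n \<kappa> \<mu>}. (\<lambda>T. T @ [\<mu>]) ` walks n \<kappa>)"
  then obtain S where "T = S @ [\<mu>]" "S \<in> walks n (S ! n)" "step n (S ! n) \<mu>"
    by (auto simp: walks_def)
  then show "T \<in> walks (Suc n) \<mu>"
    by (auto simp: walks_def nth_append less_Suc_eq)
qed

lemma finite_step: "finite {\<kappa>. step n \<kappa> \<mu>}"
  using finite_grows_to finite_grows_from by (cases "even n") (simp_all add: step_def)

lemma finite_walks: "finite (walks n \<mu>)"
  by (induction n arbitrary: \<mu>) (simp_all add: walks_0 walks_Suc finite_step)

lemma card_walks_Suc: "card (walks (Suc n) \<mu>) = (\<Sum>\<kappa> | step n \<kappa> \<mu>. card (walks n \<kappa>))"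
proof -
  have "card (walks (Suc n) \<mu>) = (\<Sum>\<kappa> | step n \<kappa> \<mu>. card ((\<lambda>T. T @ [\<mu>]) ` walks n \<kappa>))"
    unfolding walks_Suc
    by (rule card_UN_disjoint) (simp_all add: finite_step finite_walks, auto simp: walks_def)
  then show ?thesis by (simp add: card_image inj_on_def)
qed

lemma card_walks_even: "card (walks (2 * n) \<mu>) = updown_iterate n \<mu>"
proof (induction n arbitrary: \<mu>)
  case 0
  then show ?case by (simp add: walks_0 updown_iterate_0 empty_indicator_def)
next
  case (Suc n)
  then show ?case
    by (simp add: card_walks_Suc step_def updown_iterate_Suc Up_def Down_def)
qed

lemma card_walks_odd: "card (walks (2 * n + 1) \<mu>) = Down (updown_iterate n) \<mu>"
  by (simp add: card_walks_Suc card_walks_even step_def Down_def)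

lemma svt_iff_walk: "simplified_vacillating_tableau k \<mu> T \<longleftrightarrow> T \<in> walks (2 * k + 1) \<mu>"
proof
  assume T: "simplified_vacillating_tableau k \<mu> T"
  then have len: "length T = 2 * k + 2" and ip: "\<And>i. i < 2 * k + 2 \<Longrightarrow> integer_partition (T ! i)"
    by (auto simp: simplified_vacillating_tableau_def)
  have "step i (T ! i) (T ! Suc i)" if "i < 2 * k + 1" for i
  proof (cases "even i")
    case True
    then obtain j where "i = 2 * j" by blast
    then show ?thesis using T ip that
      by (simp add: step_def grows_def simplified_vacillating_tableau_def)
  next
    case False
    then obtain j where "i = 2 * j + 1" by (auto elim: oddE)
    then show ?thesis using T ip that
      by (simp add: step_def grows_def simplified_vacillating_tableau_def)
  qed
  then show "T \<in> walks (2 * k + 1) \<mu>"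
    using T by (simp add: walks_def simplified_vacillating_tableau_def)
next
  assume T: "T \<in> walks (2 * k + 1) \<mu>"
  then have len: "length T = 2 * k + 2" by (simp add: walks_def)
  have down: "grows (T ! (2 * j + 1)) (T ! (2 * j))" if "j \<le> k" for j
  proof -
    have "step (2 * j) (T ! (2 * j)) (T ! Suc (2 * j))" using T that by (simp add: walks_def)
    then show ?thesis by (simp add: step_def)
  qed
  have up: "grows (T ! (2 * j + 1)) (T ! (2 * j + 2))" if "j < k" for j
  proof -
    have "step (2 * j + 1) (T ! (2 * j + 1)) (T ! Suc (2 * j + 1))" using T that by (simp add: walks_def)
    then show ?thesis by (simp add: step_def)
  qed
  have "integer_partition (T ! i)" if "i < 2 * k + 2" for i
  proof (cases "even i")
    case True
    then obtain j where "i = 2 * j" by blast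
    then show ?thesis using down[of j] that by (simp add: grows_def)
  next
    case False
    then obtain j where "i = 2 * j + 1" by (auto elim: oddE)
    then show ?thesis using down[of j] that by (simp add: grows_def)
  qed
  then have "\<forall>\<nu>\<in>set T. integer_partition \<nu>" using len by (metis in_set_conv_nth)
  then show "simplified_vacillating_tableau k \<mu> T"
    using T len down up unfolding simplified_vacillating_tableau_def grows_def
    by (simp add: walks_def)
qed

lemma num_svt_eq: "num_svt k \<mu> = Down (updown_iterate k) \<mu>"
  using card_walks_odd[of k \<mu>] by (simp add: num_svt_def svt_iff_walk)

theorem theorem9:
  fixes k1 k2 :: nat
  shows "((\<lambda>\<mu>. num_svt k1 \<mu> * num_svt k2 \<mu>) has_sum bell (k1 + k2 + 1))
           {\<mu>. integer_partition \<mu>}"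
proof (rule has_sum_finite_neutralI)
  define F where "F = {\<nu>. integer_partition \<nu> \<and> sum_list \<nu> \<le> k1 + k2 + 1}"
  show "finite F" unfolding F_def by (rule finite_integer_partitions_le)
  show "F \<subseteq> {\<mu>. integer_partition \<mu>}" by (auto simp: F_def)
  show "num_svt k1 \<mu> * num_svt k2 \<mu> = 0" if "\<mu> \<in> {\<mu>. integer_partition \<mu>} - F" for \<mu>
    using that Down_updown_iterate_support[of k1 \<mu>] by (fastforce simp: F_def num_svt_eq)
  show "bell (k1 + k2 + 1) = (\<Sum>\<mu>\<in>F. num_svt k1 \<mu> * num_svt k2 \<mu>)"
    using sum_Down_updown_iterate[OF F_def, of k1 k2] by (simp add: num_svt_eq updown_iterate_Nil)
qed

end
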